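(* Let $1\le S'\le S$ be integers. If $\mathbf E[\sigma]<S'\,\mathbf E[\tau]$, then the minimal solutions $W_\infty^{0,S}$ and $W_\infty^{0,S'}$ of the stationarity equation $V\circ\theta=\Psi^{N}(V)$, $\bar{\mathbf P}$-a.s., respectively for $N=S$ and $N=S'$ servers, satisfy $W_\infty^{0,S}\prec W_\infty^{0,S'}$, $\bar{\mathbf P}$-a.s.; in other words, $\bar{\mathbf P}$-a.s., $$W_\infty^{0,S}(S-i)\le W_\infty^{0,S'}(S'-i),\quad i\in\{0,1,\dots,S'-1\},$$ $$\sum_{i=1}^S W_\infty^{0,S}(i)\le\sum_{i=1}^{S'}W_\infty^{0,S'}(i).$$
   Context: Notation: $x\wedge y=\min(x,y)$, $x\vee y=\max(x,y)$, $x^+=\max(x,0)$, $\mathbb R_+=[0,\infty)$. For $u\in(\mathbb R_+)^q$, $u(i)$ is its $i$-th coordinate, and by convention $u(q+1)=\infty$. $\overline{(\mathbb R_+)^q}$ is the set of $u\in(\mathbb R_+)^q$ with $u(1)\le\dots\le u(q)$, and $\le$ on vectors is the coordinatewise order. Ordering: for positive integers $S'\le S$, $u\in(\mathbb R_+)^S$ and $v\in(\mathbb R_+)^{S'}$, write $u\prec v$ if $u(S-\ell)\le v(S'-\ell)$ for all integers $0\le\ell\le S'-1$ and $\sum_{i=1}^S u(i)\le\sum_{i=1}^{S'}v(i)$. Palm setting: $(\bar\Omega,\bar{\mathcal F},\bar{\mathbf P})$ is a probability space with a bimeasurable bijection $\theta:\bar\Omega\to\bar\Omega$ such that $\bar{\mathbf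 P}$ is $\theta$-stationary and ergodic. $\sigma\ge0$ and $\tau$ are integrable random variables on it with $\tau>0$ a.s.; $\sigma\circ\theta^n$ is the service time of customer $n$ and $\tau\circ\theta^n$ the time between the arrivals of customers $n$ and $n+1$. $\mathbf E$ is the expectation under $\bar{\mathbf P}$. For an integer $N\ge1$ (number of servers of a system of parallel queues under the Join the Shortest Workload policy), $\Psi^N$ is the random map $\overline{(\mathbb R_+)^N}\to\overline{(\mathbb R_+)^N}$, $$\Psi^N(u)(i)=[u(i)\vee((u(1)+\sigma)\wedge u(i+1))-\tau]^+,\quad 1\le i\le N,$$ i.e. the nondecreasing rearrangement of $([u(1)+\sigma-\tau]^+,[u(2)-\tau]^+,\dots,[u(N)-\tau]^+)$. A stationary service profile is an $\overline{(\mathbb R_+)^N}$-valued random variable $V$ with $V\circ\theta=\Psi^N(V)$, $\bar{\mathbf P}$-a.s. The minimal solution $W_\infty^{0,N}$ of this equation is the one given by Loynes's Theorem: it is the a.s. (coordinatewise nondecreasing) limit of the sequence $M_0^N=\mathbf 0$, $M_{n+1}^N=(\Psi^N\circ\theta^{-1})(M_n^N\circ\theta^{-1})$, where $\Psi^N\circ\theta^{-1}$ denotes the map $\Psi^N$ with $(\sigma,\tau)$ replaced by $(\sigma\circ\theta^{-1},\tau\circ\theta^{-1})$; it satisfies $W_\infty^{0,N}\le Y$ a.s. for any other solution $Y$. It is a known fact that all coordinates of $W_\infty^{0,N}$ are a.s. finite whenever $\mathbf E[\sigma]<N\,\mathbf E[\tau]$. *)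

theory Defs
  imports "HOL-Probability.Probability"
begin

text \<open>A vector of dimension \<open>q\<close> is a function on \<open>nat\<close> whose coordinates are indexed by
  \<open>{1..q}\<close> and which is \<open>undefined\<close> elsewhere, so that it is a point of the measurable
  space \<open>PiM {1..q} (\<lambda>_. borel)\<close>.\<close>

definition ordered_orthant :: "nat \<Rightarrow> (nat \<Rightarrow> real) set" where
  "ordered_orthant q = {u \<in> {1..q} \<rightarrow>\<^sub>E {0..}. \<forall>i\<in>{1..q}. \<forall>j\<in>{1..q}. i \<le> j \<longrightarrow> u i \<le> u j}"

text \<open>The relation \<open>u \<prec> v\<close> for \<open>u\<close> of dimension \<open>S\<close> and \<open>v\<close> of dimension \<open>S' \<le> S\<close>.\<close>

definition prec :: "nat \<Rightarrow> nat \<Rightarrow> (nat \<Rightarrow> real) \<Rightarrow> (nat \<Rightarrow> real) \<Rightarrow> bool" where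
  "prec S S' u v \<longleftrightarrow>
     (\<forall>l\<in>{0..S' - 1}. u (S - l) \<le> v (S' - l)) \<and> (\<Sum>i=1..S. u i) \<le> (\<Sum>i=1..S'. v i)"

text \<open>Ergodicity is only required of strictly invariant events.\<close>

locale palm_setting = prob_space M
  for M :: "'a measure" and \<theta> :: "'a \<Rightarrow> 'a" and \<sigma> \<tau> :: "'a \<Rightarrow> real" +
  assumes bij_shift: "bij_betw \<theta> (space M) (space M)"
    and measurable_shift: "\<theta> \<in> measurable M M"
    and measurable_inv_shift: "the_inv_into (space M) \<theta> \<in> measurable M M"
    and stationary: "distr M M \<theta> = M"
    and ergodic: "\<And>A. A \<in> sets M \<Longrightarrow> \<theta> -` A \<inter> space M = A \<Longrightarrow> prob A = 0 \<or> prob A = 1"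
    and integrable_service: "integrable M \<sigma>"
    and integrable_interarrival: "integrable M \<tau>"
    and service_nonneg: "AE \<omega> in M. 0 \<le> \<sigma> \<omega>"
    and interarrival_pos: "AE \<omega> in M. 0 < \<tau> \<omega>"

text \<open>One step of the Join the Shortest Workload recursion with \<open>N\<close> servers, service time \<open>s\<close>
  and interarrival time \<open>t\<close>. By the convention \<open>u (N + 1) = \<infinity>\<close>, the term
  \<open>min (u 1 + s) (u (i + 1))\<close> is \<open>u 1 + s\<close> for \<open>i = N\<close>.\<close>

definition jsw_step :: "nat \<Rightarrow> real \<Rightarrow> real \<Rightarrow> (nat \<Rightarrow> real) \<Rightarrow> (nat \<Rightarrow> real)" where
  "jsw_step N s t u =
     (\<lambda>i\<in>{1..N}. max (max (u i) (if i = N then u 1 + s else min (u 1 + s) (u (i + 1))) - t) 0)"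

definition stationary_profile ::
  "'a measure \<Rightarrow> ('a \<Rightarrow> 'a) \<Rightarrow> ('a \<Rightarrow> real) \<Rightarrow> ('a \<Rightarrow> real) \<Rightarrow> nat \<Rightarrow> ('a \<Rightarrow> nat \<Rightarrow> real) \<Rightarrow> bool"
  where
  "stationary_profile M \<theta> \<sigma> \<tau> N V \<longleftrightarrow>
     V \<in> measurable M (PiM {1..N} (\<lambda>_. borel)) \<and>
     (\<forall>\<omega>\<in>space M. V \<omega> \<in> ordered_orthant N) \<and>
     (AE \<omega> in M. V (\<theta> \<omega>) = jsw_step N (\<sigma> \<omega>) (\<tau> \<omega>) (V \<omega>))"

fun loynes_seq ::
  "'a measure \<Rightarrow> ('a \<Rightarrow> 'a) \<Rightarrow> ('a \<Rightarrow> real) \<Rightarrow> ('a \<Rightarrow> real) \<Rightarrow> nat \<Rightarrow> nat \<Rightarrow> 'a \<Rightarrow> nat \<Rightarrow> real"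
  where
  "loynes_seq M \<theta> \<sigma> \<tau> N 0 \<omega> = (\<lambda>i\<in>{1..N}. 0)"
| "loynes_seq M \<theta> \<sigma> \<tau> N (Suc n) \<omega> =
     (let \<omega>' = the_inv_into (space M) \<theta> \<omega>
      in jsw_step N (\<sigma> \<omega>') (\<tau> \<omega>') (loynes_seq M \<theta> \<sigma> \<tau> N n \<omega>'))"

definition is_minimal_solution ::
  "'a measure \<Rightarrow> ('a \<Rightarrow> 'a) \<Rightarrow> ('a \<Rightarrow> real) \<Rightarrow> ('a \<Rightarrow> real) \<Rightarrow> nat \<Rightarrow> ('a \<Rightarrow> nat \<Rightarrow> real) \<Rightarrow> bool"
  where
  "is_minimal_solution M \<theta> \<sigma> \<tau> N W \<longleftrightarrow>
     stationary_profile M \<theta> \<sigma> \<tau> N W \<and>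
     (AE \<omega> in M. \<forall>i\<in>{1..N}. (\<lambda>n. loynes_seq M \<theta> \<sigma> \<tau> N n \<omega> i) \<longlonglongrightarrow> W \<omega> i) \<and>
     (\<forall>Y. stationary_profile M \<theta> \<sigma> \<tau> N Y \<longrightarrow> (AE \<omega> in M. \<forall>i\<in>{1..N}. W \<omega> i \<le> Y \<omega> i))"

text \<open>Solutions in the sense of \<open>is_minimal_solution\<close> agree almost surely, so the choice below
  merely selects a version of \<open>W\<^sub>\<infinity>\<^sup>0\<close>. A version with finite coordinates exists when the mean of
  \<open>\<sigma>\<close> is less than \<open>N\<close> times the mean of \<open>\<tau>\<close>. Any statement using this choice has
  to establish that existence.\<close>

definition minimal_solution ::
  "'a measure \<Rightarrow> ('a \<Rightarrow> 'a) \<Rightarrow> ('a \<Rightarrow> real) \<Rightarrow> ('a \<Rightarrow> real) \<Rightarrow> nat \<Rightarrow> 'a \<Rightarrow> nat \<Rightarrow> real" where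
  "minimal_solution M \<theta> \<sigma> \<tau> N = (SOME W. is_minimal_solution M \<theta> \<sigma> \<tau> N W)"

end

theory Submission
  imports Defs
begin

text \<open>The relation \<open>\<prec>\<close> is preserved by one step of the recursion when both systems receive the
  same customer (\<open>prec_jsw_step\<close>). On the arrival, the total workloads both grow by \<open>s\<close>, and since
  the smallest workload of the larger system is below that of the smaller one, the top coordinates
  stay in order. Removing \<open>t\<close> from every server then costs the larger system at least as much,
  unless its additional servers become idle, in which case the coordinatewise order settles the
  comparison of the sums. Both Loynes sequences start from the empty profile and are driven by the
  same customers, so they are comparable at every index (\<open>prec_loynes\<close>), and \<open>\<prec>\<close> is closed under
  limits.

  The remaining part is that the Loynes sequence with \<open>N\<close> servers converges to finite values when
  the mean of \<open>\<sigma>\<close> is less than \<open>N\<close> times the mean of \<open>\<tau>\<close>; otherwise the minimal solution would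
  not denote anything. The sequence is nondecreasing, and one step changes each coordinate by a
  bounded amount, at least \<open>-\<tau>\<close> and at most \<open>\<sigma>\<close>. Hence the divergence of a given coordinate is an
  invariant event, which has probability 0 or 1 by ergodicity (\<open>explodes_0_or_1\<close>). Suppose that
  some coordinate diverges, and let \<open>j + 1\<close> be the first one that does so almost surely. By
  stationarity the mean of the sum over the coordinates \<open>j + 1, \<dots>, N\<close> does not decrease in one
  step. In the limit these servers work without pause, so that they remove \<open>(N - j) \<tau>\<close>; if \<open>j > 0\<close>
  no customer reaches them because the first server stays finite, and if \<open>j = 0\<close> they receive
  exactly \<open>\<sigma>\<close>. In both cases the mean change is negative, a contradiction
  (\<open>not_explodes_tail\<close>).\<close>

section \<open>One step of the recursion\<close>

text \<open>The ordered profile just after the arrival, before any work is removed. Separating it from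
  the removal makes the workload balance \<open>sum_join_shortest\<close> an exact identity.\<close>

definition join_shortest :: "nat \<Rightarrow> real \<Rightarrow> (nat \<Rightarrow> real) \<Rightarrow> nat \<Rightarrow> real" where
  "join_shortest N s u i = max (u i) (if i = N then u 1 + s else min (u 1 + s) (u (i + 1)))"

lemma jsw_step_eq:
  "i \<in> {1..N} \<Longrightarrow> jsw_step N s t u i = max (join_shortest N s u i - t) 0"
  by (simp add: jsw_step_def join_shortest_def)

lemma ordered_orthantD:
  assumes "u \<in> ordered_orthant N"
  shows "i \<in> {1..N} \<Longrightarrow> 0 \<le> u i"
    and "i \<in> {1..N} \<Longrightarrow> k \<in> {1..N} \<Longrightarrow> i \<le> k \<Longrightarrow> u i \<le> u k"
  using assms unfolding ordered_orthant_def by (auto simp: PiE_iff)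

lemma zero_in_ordered_orthant: "(\<lambda>i\<in>{1..N}. 0) \<in> ordered_orthant N"
  by (auto simp: ordered_orthant_def)

lemma join_shortest_mono:
  assumes u: "u \<in> ordered_orthant N" and i: "i \<in> {1..N}" and k: "k \<in> {1..N}" and "i \<le> k"
  shows "join_shortest N s u i \<le> join_shortest N s u k"
proof (cases "i = k")
  case False
  then have "i + 1 \<in> {1..N}" "i + 1 \<le> k" "i \<noteq> N" using assms by auto
  then have "u (i + 1) \<le> u k" "u i \<le> u k" using ordered_orthantD(2)[OF u] assms by auto
  then show ?thesis using \<open>i \<noteq> N\<close> by (auto simp: join_shortest_def)
qed simp

lemma join_shortest_ge: "u i \<le> join_shortest N s u i"
  by (simp add: join_shortest_def)

text \<open>A coordinate grows by at most \<open>s\<close> because \<open>u 1\<close> is the smallest one.\<close>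

lemma join_shortest_le:
  assumes "u \<in> ordered_orthant N" "0 \<le> s" "i \<in> {1..N}"
  shows "join_shortest N s u i \<le> u i + s"
  using ordered_orthantD(2)[OF assms(1), of 1 i] assms by (auto simp: join_shortest_def)

text \<open>Writing \<open>a\<close> for \<open>u 1 + s\<close>, the new coordinate is \<open>u i + (a - u i)\<^sup>+ - (a - u (i + 1))\<^sup>+\<close>,
  so the positive parts telescope.\<close>

lemma sum_join_shortest:
  assumes u: "u \<in> ordered_orthant N" and "0 \<le> s" "1 \<le> N"
  shows "(\<Sum>i=1..N. join_shortest N s u i) = (\<Sum>i=1..N. u i) + s"
proof -
  define p where "p i = (if i \<le> N then max (u 1 + s - u i) 0 else 0)" for i
  have eq: "join_shortest N s u i = u i + (p i - p (Suc i))" if "i \<in> {1..N}" for i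
  proof (cases "i = N")
    case False
    then have "u i \<le> u (Suc i)" using ordered_orthantD(2)[OF u] that by auto
    then show ?thesis using False that by (auto simp: join_shortest_def p_def)
  qed (auto simp: join_shortest_def p_def)
  have "(\<Sum>i=1..N. p i - p (Suc i)) = p 1 - p (Suc N)"
    using sum_Suc_diff[of 1 N "\<lambda>i. - p i"] \<open>1 \<le> N\<close> by simp
  also have "\<dots> = s" using assms by (simp add: p_def)
  finally show ?thesis using eq by (simp add: sum.distrib)
qed

lemma jsw_step_ordered:
  assumes "u \<in> ordered_orthant N"
  shows "jsw_step N s t u \<in> ordered_orthant N"
proof -
  have "jsw_step N s t u i \<le> jsw_step N s t u k" if "i \<in> {1..N}" "k \<in> {1..N}" "i \<le> k" for i k
    unfolding jsw_step_eq[OF that(1)] jsw_step_eq[OF that(2)]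
    using join_shortest_mono[OF assms that, of s] by linarith
  moreover have "jsw_step N s t u \<in> {1..N} \<rightarrow>\<^sub>E {0..}"
    by (auto simp: jsw_step_def)
  ultimately show ?thesis by (auto simp: ordered_orthant_def)
qed

lemma jsw_step_mono:
  assumes "\<And>k. k \<in> {1..N} \<Longrightarrow> u k \<le> v k" "i \<in> {1..N}"
  shows "jsw_step N s t u i \<le> jsw_step N s t v i"
proof -
  have "u 1 \<le> v 1" "u i \<le> v i" "i \<noteq> N \<Longrightarrow> u (Suc i) \<le> v (Suc i)" using assms by auto
  then have "join_shortest N s u i \<le> join_shortest N s v i"
    by (auto simp: join_shortest_def)
  then show ?thesis using assms(2) by (auto simp: jsw_step_eq)
qed

text \<open>Each coordinate is controlled by its own previous value alone, although the step mixes
  coordinates. This is what makes the divergence of a single coordinate an invariant event.\<close>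

lemma jsw_step_increment:
  assumes "u \<in> ordered_orthant N" "0 \<le> s" "0 \<le> t" "i \<in> {1..N}"
  shows "u i - t \<le> jsw_step N s t u i" and "jsw_step N s t u i \<le> u i + s"
  using join_shortest_le[OF assms(1,2,4)] join_shortest_ge[of u i N s]
    ordered_orthantD(1)[OF assms(1,4)] assms(2-) by (auto simp: jsw_step_eq)

lemma tendsto_jsw_step:
  assumes lim: "\<And>k. k \<in> {1..N} \<Longrightarrow> (\<lambda>n. u n k) \<longlonglongrightarrow> v k" and i: "i \<in> {1..N}"
  shows "(\<lambda>n. jsw_step N s t (u n) i) \<longlonglongrightarrow> jsw_step N s t v i"
proof (cases "i = N")
  case True
  have "(\<lambda>n. u n N) \<longlonglongrightarrow> v N" "(\<lambda>n. u n 1) \<longlonglongrightarrow> v 1" using lim i True by auto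
  then show ?thesis
    using True i unfolding jsw_step_eq[OF i] join_shortest_def
    by (auto intro!: tendsto_intros)
next
  case False
  then have "(\<lambda>n. u n i) \<longlonglongrightarrow> v i" "(\<lambda>n. u n 1) \<longlonglongrightarrow> v 1" "(\<lambda>n. u n (Suc i)) \<longlonglongrightarrow> v (Suc i)"
    using lim i by auto
  then show ?thesis
    using False unfolding jsw_step_eq[OF i] join_shortest_def
    by (auto intro!: tendsto_intros)
qed

section \<open>The ordering is preserved by one step\<close>

lemma sum_split_first:
  fixes f :: "nat \<Rightarrow> real"
  shows "(\<Sum>i=1..d + n. f i) = (\<Sum>i=1..d. f i) + (\<Sum>i=1..n. f (d + i))"
proof (induction n)
  case (Suc n)
  then show ?case by simp
qed simp

text \<open>Counting from the bottom, with \<open>d\<close> additional servers in the larger system, avoids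
  truncated subtraction.\<close>

lemma prec_iff:
  assumes "1 \<le> S'"
  shows "prec (d + S') S' u v \<longleftrightarrow>
    (\<forall>i\<in>{1..S'}. u (d + i) \<le> v i) \<and> (\<Sum>i=1..d + S'. u i) \<le> (\<Sum>i=1..S'. v i)"
proof -
  have "(\<forall>l\<in>{0..S' - 1}. u (d + S' - l) \<le> v (S' - l)) \<longleftrightarrow> (\<forall>i\<in>{1..S'}. u (d + i) \<le> v i)"
    (is "?L \<longleftrightarrow> ?R")
  proof
    assume L: ?L
    show ?R
    proof
      fix i assume i: "i \<in> {1..S'}"
      then have "S' - i \<in> {0..S' - 1}" "d + S' - (S' - i) = d + i" "S' - (S' - i) = i" by auto
      then show "u (d + i) \<le> v i" using L by metis
    qed
  next
    assume R: ?R
    show ?L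
    proof
      fix l assume l: "l \<in> {0..S' - 1}"
      then have "S' - l \<in> {1..S'}" "d + (S' - l) = d + S' - l" using assms by auto
      then show "u (d + S' - l) \<le> v (S' - l)" using R by metis
    qed
  qed
  then show ?thesis by (simp add: prec_def)
qed

text \<open>If the work time \<open>t\<close> exhausts the smallest of the \<open>S'\<close> largest coordinates of \<open>x\<close>, the
  coordinates below it vanish as well, and the comparison of sums is the coordinatewise one.
  Otherwise each of the \<open>S'\<close> largest coordinates of \<open>x\<close> and all coordinates of \<open>y\<close> lose
  exactly \<open>t\<close>, so that the sum over \<open>x\<close> decreases by at least as much as the sum over \<open>y\<close>.\<close>

lemma sum_drain_le:
  fixes x y :: "nat \<Rightarrow> real"
  assumes "0 \<le> t" and "1 \<le> S'"
    and nonneg: "\<And>i. i \<in> {1..d + S'} \<Longrightarrow> 0 \<le> x i"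
    and mono: "\<And>i k. i \<in> {1..d + S'} \<Longrightarrow> k \<in> {1..d + S'} \<Longrightarrow> i \<le> k \<Longrightarrow> x i \<le> x k"
    and le: "\<And>i. i \<in> {1..S'} \<Longrightarrow> x (d + i) \<le> y i"
    and sum_le: "(\<Sum>i=1..d + S'. x i) \<le> (\<Sum>i=1..S'. y i)"
  shows "(\<Sum>i=1..d + S'. max (x i - t) 0) \<le> (\<Sum>i=1..S'. max (y i - t) 0)"
proof (cases "x (d + 1) \<le> t")
  case True
  have "x i \<le> t" if "i \<in> {1..d}" for i
    using mono[of i "d + 1"] that True \<open>1 \<le> S'\<close> by auto
  then have "(\<Sum>i=1..d. max (x i - t) 0) = 0" by (intro sum.neutral) auto
  moreover have "(\<Sum>i=1..S'. max (x (d + i) - t) 0) \<le> (\<Sum>i=1..S'. max (y i - t) 0)"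
    using le by (intro sum_mono max.mono diff_right_mono) auto
  ultimately show ?thesis unfolding sum_split_first by simp
next
  case False
  have "t \<le> x (d + i)" if "i \<in> {1..S'}" for i
    using mono[of "d + 1" "d + i"] that False \<open>1 \<le> S'\<close> by auto
  then have "(\<Sum>i=1..S'. max (x (d + i) - t) 0) = (\<Sum>i=1..S'. x (d + i) - t)"
    by (intro sum.cong) auto
  moreover have "(\<Sum>i=1..d. max (x i - t) 0) \<le> (\<Sum>i=1..d. x i)"
    using nonneg \<open>0 \<le> t\<close> by (intro sum_mono) auto
  moreover have "(\<Sum>i=1..S'. y i - t) \<le> (\<Sum>i=1..S'. max (y i - t) 0)"
    by (intro sum_mono) auto
  ultimately show ?thesis
    using sum_le unfolding sum_split_first by (simp add: sum_subtractf)
qed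

text \<open>The smallest workload of the larger system satisfies \<open>u 1 \<le> u (d + 1) \<le> v 1\<close>. Therefore the
  level \<open>u 1 + s\<close> at which the arriving work is inserted is also lower in the larger system, and
  the coordinatewise part of the relation survives the arrival; the sums grow by the same \<open>s\<close>. The
  removal of work is \<open>sum_drain_le\<close>.\<close>

lemma prec_jsw_step:
  assumes u: "u \<in> ordered_orthant (d + S')" and v: "v \<in> ordered_orthant S'"
    and "1 \<le> S'" "0 \<le> s" "0 \<le> t" and uv: "prec (d + S') S' u v"
  shows "prec (d + S') S' (jsw_step (d + S') s t u) (jsw_step S' s t v)"
proof -
  let ?x = "join_shortest (d + S') s u" and ?y = "join_shortest S' s v"
  have le: "u (d + i) \<le> v i" if "i \<in> {1..S'}" for i
    using uv that prec_iff[OF \<open>1 \<le> S'\<close>] by blast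
  have "u 1 \<le> u (d + 1)" using ordered_orthantD(2)[OF u, of 1 "d + 1"] \<open>1 \<le> S'\<close> by auto
  also have "\<dots> \<le> v 1" using le[of 1] \<open>1 \<le> S'\<close> by auto
  finally have first: "u 1 \<le> v 1" .
  have xy: "?x (d + i) \<le> ?y i" if i: "i \<in> {1..S'}" for i
  proof (cases "i = S'")
    case True
    then show ?thesis using first le[OF i] by (auto simp: join_shortest_def)
  next
    case False
    then have "u (d + (i + 1)) \<le> v (i + 1)" using i by (intro le) auto
    then show ?thesis using first le[OF i] False by (auto simp: join_shortest_def)
  qed
  have "(\<Sum>i=1..d + S'. max (?x i - t) 0) \<le> (\<Sum>i=1..S'. max (?y i - t) 0)"
  proof (rule sum_drain_le)
    show "0 \<le> ?x i" if "i \<in> {1..d + S'}" for i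
      using ordered_orthantD(1)[OF u that] join_shortest_ge[of u i "d + S'" s] by linarith
    show "(\<Sum>i=1..d + S'. ?x i) \<le> (\<Sum>i=1..S'. ?y i)"
      using uv prec_iff[OF \<open>1 \<le> S'\<close>, of d u v] sum_join_shortest[OF u, of s]
        sum_join_shortest[OF v, of s] \<open>1 \<le> S'\<close> \<open>0 \<le> s\<close> by simp
  qed (use assms xy join_shortest_mono[OF u] in auto)
  then have "(\<Sum>i=1..d + S'. jsw_step (d + S') s t u i) \<le> (\<Sum>i=1..S'. jsw_step S' s t v i)"
    by (simp add: jsw_step_eq)
  moreover have "jsw_step (d + S') s t u (d + i) \<le> jsw_step S' s t v i" if "i \<in> {1..S'}" for i
    using xy[OF that] that by (auto simp: jsw_step_eq)
  ultimately show ?thesis using prec_iff[OF \<open>1 \<le> S'\<close>] by blast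
qed

lemma prec_tendsto:
  assumes "1 \<le> S'" and "\<And>n. prec (d + S') S' (u n) (v n)"
    and u: "\<And>i. i \<in> {1..d + S'} \<Longrightarrow> (\<lambda>n. u n i) \<longlonglongrightarrow> x i"
    and v: "\<And>i. i \<in> {1..S'} \<Longrightarrow> (\<lambda>n. v n i) \<longlonglongrightarrow> y i"
  shows "prec (d + S') S' x y"
proof -
  have le: "u n (d + i) \<le> v n i" if "i \<in> {1..S'}" for n i
    using assms(2) prec_iff[OF \<open>1 \<le> S'\<close>] that by blast
  have "x (d + i) \<le> y i" if "i \<in> {1..S'}" for i
    using that by (intro LIMSEQ_le[OF u v]) (use le in auto)
  moreover have "(\<Sum>i=1..d + S'. x i) \<le> (\<Sum>i=1..S'. y i)"
  proof (rule LIMSEQ_le[OF tendsto_sum tendsto_sum])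
    show "\<exists>m. \<forall>n\<ge>m. (\<Sum>i=1..d + S'. u n i) \<le> (\<Sum>i=1..S'. v n i)"
      using assms(2) prec_iff[OF \<open>1 \<le> S'\<close>] by blast
  qed (use u v in auto)
  ultimately show ?thesis using prec_iff[OF \<open>1 \<le> S'\<close>] by blast
qed

section \<open>The measure-preserving shift\<close>

context palm_setting
begin

abbreviation shift_inv :: "'a \<Rightarrow> 'a" where
  "shift_inv \<equiv> the_inv_into (space M) \<theta>"

abbreviation loynes :: "nat \<Rightarrow> nat \<Rightarrow> 'a \<Rightarrow> nat \<Rightarrow> real" where
  "loynes \<equiv> loynes_seq M \<theta> \<sigma> \<tau>"

lemma shift_inv_shift: "\<omega> \<in> space M \<Longrightarrow> shift_inv (\<theta> \<omega>) = \<omega>"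
  using bij_shift by (auto simp: bij_betw_def the_inv_into_f_f)

lemma shift_shift_inv: "\<omega> \<in> space M \<Longrightarrow> \<theta> (shift_inv \<omega>) = \<omega>"
  using bij_shift by (auto simp: bij_betw_def f_the_inv_into_f)

lemma stationary_inv: "distr M M shift_inv = M"
proof -
  have "distr M M shift_inv = distr (distr M M \<theta>) M shift_inv" by (simp add: stationary)
  also have "\<dots> = distr M M (shift_inv \<circ> \<theta>)"
    by (rule distr_distr[OF measurable_inv_shift measurable_shift])
  also have "\<dots> = distr M M (\<lambda>\<omega>. \<omega>)"
    by (rule distr_cong) (auto simp: shift_inv_shift)
  finally show ?thesis by (simp add: distr_id)
qed

lemma AE_shift: "AE \<omega> in M. P \<omega> \<Longrightarrow> AE \<omega> in M. P (\<theta> \<omega>)"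
  by (rule AE_distrD[OF measurable_shift]) (subst stationary)

lemma AE_shift_inv: "AE \<omega> in M. P \<omega> \<Longrightarrow> AE \<omega> in M. P (shift_inv \<omega>)"
  by (rule AE_distrD[OF measurable_inv_shift]) (subst stationary_inv)

lemma integrable_shift_inv:
  fixes f :: "'a \<Rightarrow> real"
  assumes "integrable M f"
  shows "integrable M (\<lambda>\<omega>. f (shift_inv \<omega>))"
  by (rule integrable_distr[OF measurable_inv_shift]) (simp add: stationary_inv assms)

lemma integral_shift_inv:
  fixes f :: "'a \<Rightarrow> real"
  assumes "integrable M f"
  shows "(\<integral>\<omega>. f (shift_inv \<omega>) \<partial>M) = (\<integral>\<omega>. f \<omega> \<partial>M)"
  using integral_distr[OF measurable_inv_shift, of f] borel_measurable_integrable[OF assms]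
  by (simp add: stationary_inv)

text \<open>An almost surely invariant event agrees almost surely with the event that its
  translates occur infinitely often, which is strictly invariant.\<close>

lemma ergodic_AE:
  assumes A: "A \<in> sets M" and inv: "AE \<omega> in M. \<theta> \<omega> \<in> A \<longleftrightarrow> \<omega> \<in> A"
  shows "prob A = 0 \<or> prob A = 1"
proof -
  define B where "B = {\<omega> \<in> space M. \<forall>n. \<exists>k\<ge>n. (\<theta> ^^ k) \<omega> \<in> A}"
  have pow[measurable]: "(\<lambda>\<omega>. (\<theta> ^^ k) \<omega>) \<in> measurable M M" for k
  proof (induction k)
    case (Suc k)
    show ?case using measurable_compose[OF Suc measurable_shift] by simp
  qed simp
  have B: "B \<in> sets M" unfolding B_def using A by measurable
  have sp: "\<theta> \<omega> \<in> space M" if "\<omega> \<in> space M" for \<omega>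
    using measurable_space[OF measurable_shift that] .
  have "\<theta> -` B \<inter> space M = B"
  proof -
    have "(\<forall>n. \<exists>k\<ge>n. (\<theta> ^^ k) (\<theta> \<omega>) \<in> A) \<longleftrightarrow> (\<forall>n. \<exists>k\<ge>n. (\<theta> ^^ k) \<omega> \<in> A)" for \<omega>
    proof -
      have *: "(\<theta> ^^ k) (\<theta> \<omega>) = (\<theta> ^^ Suc k) \<omega>" for k by (simp add: funpow_swap1)
      have "(\<exists>k\<ge>n. (\<theta> ^^ k) (\<theta> \<omega>) \<in> A) \<longleftrightarrow> (\<exists>k\<ge>Suc n. (\<theta> ^^ k) \<omega> \<in> A)" for n
        unfolding * by (metis Suc_le_D Suc_le_mono)
      moreover have "(\<forall>n. \<exists>k\<ge>Suc n. (\<theta> ^^ k) \<omega> \<in> A) \<longleftrightarrow> (\<forall>n. \<exists>k\<ge>n. (\<theta> ^^ k) \<omega> \<in> A)"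
        by (auto intro: Suc_leD)
      ultimately show ?thesis by simp
    qed
    then show ?thesis unfolding B_def using sp by auto
  qed
  then have "prob B = 0 \<or> prob B = 1" using ergodic[OF B] by blast
  moreover have "prob A = prob B"
  proof (rule finite_measure_eq_AE)
    have all: "AE \<omega> in M. (\<theta> ^^ k) \<omega> \<in> A \<longleftrightarrow> \<omega> \<in> A" for k
    proof (induction k)
      case (Suc k)
      from AE_shift[OF Suc] inv show ?case
        by eventually_elim (simp add: funpow_swap1)
    qed simp
    have "AE \<omega> in M. \<forall>k. (\<theta> ^^ k) \<omega> \<in> A \<longleftrightarrow> \<omega> \<in> A"
      using all by (simp add: AE_all_countable)
    then show "AE \<omega> in M. \<omega> \<in> A \<longleftrightarrow> \<omega> \<in> B"
      using AE_space by eventually_elim (auto simp: B_def)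
  qed (use A B in auto)
  ultimately show ?thesis by simp
qed

lemma interarrival_mean_pos: "0 < (\<integral>\<omega>. \<tau> \<omega> \<partial>M)"
proof -
  have nn: "AE \<omega> in M. 0 \<le> \<tau> \<omega>" using interarrival_pos by eventually_elim simp
  have "(\<integral>\<omega>. \<tau> \<omega> \<partial>M) \<noteq> 0"
  proof
    assume "(\<integral>\<omega>. \<tau> \<omega> \<partial>M) = 0"
    then have "AE \<omega> in M. \<tau> \<omega> = 0"
      using integral_nonneg_eq_0_iff_AE[OF integrable_interarrival nn] by simp
    with interarrival_pos have "AE \<omega> in M. False" by eventually_elim simp
    then show False by simp
  qed
  moreover have "0 \<le> (\<integral>\<omega>. \<tau> \<omega> \<partial>M)" using nn by (rule integral_nonneg_AE)
  ultimately show ?thesis by simp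
qed

section \<open>The Loynes sequence\<close>

lemma loynes_Suc:
  "loynes N (Suc n) \<omega> =
     jsw_step N (\<sigma> (shift_inv \<omega>)) (\<tau> (shift_inv \<omega>)) (loynes N n (shift_inv \<omega>))"
  by (simp add: Let_def)

declare loynes_seq.simps(2)[simp del]

lemma loynes_Suc_shift:
  "\<omega> \<in> space M \<Longrightarrow> loynes N (Suc n) (\<theta> \<omega>) = jsw_step N (\<sigma> \<omega>) (\<tau> \<omega>) (loynes N n \<omega>)"
  by (simp add: loynes_Suc shift_inv_shift)

lemma borel_measurable_jsw_step:
  assumes "\<And>k. k \<in> {1..N} \<Longrightarrow> (\<lambda>\<omega>. V \<omega> k) \<in> borel_measurable M" and i: "i \<in> {1..N}"
  shows "(\<lambda>\<omega>. jsw_step N (\<sigma> \<omega>) (\<tau> \<omega>) (V \<omega>) i) \<in> borel_measurable M"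
proof -
  have [measurable]: "(\<lambda>\<omega>. V \<omega> (Suc 0)) \<in> borel_measurable M" "(\<lambda>\<omega>. V \<omega> i) \<in> borel_measurable M"
    "\<sigma> \<in> borel_measurable M" "\<tau> \<in> borel_measurable M"
    using assms integrable_service integrable_interarrival by auto
  show ?thesis
  proof (cases "i = N")
    case True
    then have "(\<lambda>\<omega>. jsw_step N (\<sigma> \<omega>) (\<tau> \<omega>) (V \<omega>) i) =
        (\<lambda>\<omega>. max (max (V \<omega> i) (V \<omega> (Suc 0) + \<sigma> \<omega>) - \<tau> \<omega>) 0)"
      using i by (auto simp: jsw_step_eq join_shortest_def)
    then show ?thesis by simp
  next
    case False
    then have [measurable]: "(\<lambda>\<omega>. V \<omega> (Suc i)) \<in> borel_measurable M" using i assms by auto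
    show ?thesis using i False by (simp add: jsw_step_eq join_shortest_def)
  qed
qed

lemma borel_measurable_loynes:
  "i \<in> {1..N} \<Longrightarrow> (\<lambda>\<omega>. loynes N n \<omega> i) \<in> borel_measurable M"
proof (induction n arbitrary: i)
  case (Suc n)
  show ?case unfolding loynes_Suc
    by (rule measurable_compose[OF measurable_inv_shift borel_measurable_jsw_step[OF Suc]])
qed simp

lemma loynes_ordered: "loynes N n \<omega> \<in> ordered_orthant N"
proof (induction n arbitrary: \<omega>)
  case 0
  then show ?case unfolding loynes_seq.simps(1) by (rule zero_in_ordered_orthant)
next
  case (Suc n)
  then show ?case by (simp add: loynes_Suc jsw_step_ordered)
qed

lemma loynes_incseq:
  "\<forall>i\<in>{1..N}. loynes N n \<omega> i \<le> loynes N (Suc n) \<omega> i"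
proof (induction n arbitrary: \<omega>)
  case 0
  show ?case using ordered_orthantD(1)[OF loynes_ordered[of N "Suc 0" \<omega>]] by simp
next
  case (Suc n)
  show ?case
    unfolding loynes_Suc[of N n \<omega>] loynes_Suc[of N "Suc n" \<omega>]
    using Suc[of "shift_inv \<omega>"] by (intro ballI jsw_step_mono) auto
qed

lemma incseq_loynes: "i \<in> {1..N} \<Longrightarrow> incseq (\<lambda>n. loynes N n \<omega> i)"
  using loynes_incseq by (intro incseq_SucI) auto

lemma AE_increment:
  assumes "i \<in> {1..N}"
  shows "AE \<omega> in M. \<forall>n. loynes N n \<omega> i - \<tau> \<omega> \<le> jsw_step N (\<sigma> \<omega>) (\<tau> \<omega>) (loynes N n \<omega>) i \<and>
    jsw_step N (\<sigma> \<omega>) (\<tau> \<omega>) (loynes N n \<omega>) i \<le> loynes N n \<omega> i + \<sigma> \<omega>"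
  using service_nonneg interarrival_pos
  by eventually_elim (use assms jsw_step_increment[OF loynes_ordered] in auto)

lemma integrable_loynes:
  assumes i: "i \<in> {1..N}"
  shows "integrable M (\<lambda>\<omega>. loynes N n \<omega> i)"
    and "integrable M (\<lambda>\<omega>. jsw_step N (\<sigma> \<omega>) (\<tau> \<omega>) (loynes N n \<omega>) i)"
proof -
  have step: "integrable M (\<lambda>\<omega>. jsw_step N (\<sigma> \<omega>) (\<tau> \<omega>) (loynes N n \<omega>) i)"
    if "integrable M (\<lambda>\<omega>. loynes N n \<omega> i)" for n
  proof (rule Bochner_Integration.integrable_bound)
    show "integrable M (\<lambda>\<omega>. loynes N n \<omega> i + \<sigma> \<omega>)" using that integrable_service by simp
    show "(\<lambda>\<omega>. jsw_step N (\<sigma> \<omega>) (\<tau> \<omega>) (loynes N n \<omega>) i) \<in> borel_measurable M"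
      using borel_measurable_jsw_step[OF borel_measurable_loynes i] .
    show "AE \<omega> in M. norm (jsw_step N (\<sigma> \<omega>) (\<tau> \<omega>) (loynes N n \<omega>) i)
        \<le> norm (loynes N n \<omega> i + \<sigma> \<omega>)"
      using AE_increment[OF i]
    proof eventually_elim
      case (elim \<omega>)
      then have "jsw_step N (\<sigma> \<omega>) (\<tau> \<omega>) (loynes N n \<omega>) i \<le> loynes N n \<omega> i + \<sigma> \<omega>" by blast
      moreover have "0 \<le> jsw_step N (\<sigma> \<omega>) (\<tau> \<omega>) (loynes N n \<omega>) i"
        using i by (simp add: jsw_step_eq)
      ultimately show ?case by simp
    qed
  qed
  show L: "integrable M (\<lambda>\<omega>. loynes N n \<omega> i)" for n
  proof (induction n)
    case (Suc n)
    show ?case unfolding loynes_Suc by (rule integrable_shift_inv[OF step[OF Suc]])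
  qed (use i in simp)
  show "integrable M (\<lambda>\<omega>. jsw_step N (\<sigma> \<omega>) (\<tau> \<omega>) (loynes N n \<omega>) i)" by (rule step[OF L])
qed

text \<open>Stationarity turns the monotonicity of the Loynes sequence into a nonnegative mean
  increment: the profile after one step has the law of the next, larger, member of the sequence.\<close>

lemma mean_increment_nonneg:
  assumes "I \<subseteq> {1..N}"
  shows "0 \<le> (\<integral>\<omega>. (\<Sum>i\<in>I. jsw_step N (\<sigma> \<omega>) (\<tau> \<omega>) (loynes N n \<omega>) i - loynes N n \<omega> i) \<partial>M)"
proof -
  have "0 \<le> (\<integral>\<omega>. jsw_step N (\<sigma> \<omega>) (\<tau> \<omega>) (loynes N n \<omega>) i - loynes N n \<omega> i \<partial>M)"
    if "i \<in> I" for i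
  proof -
    have i: "i \<in> {1..N}" using that assms by auto
    have "(\<integral>\<omega>. loynes N n \<omega> i \<partial>M) \<le> (\<integral>\<omega>. loynes N (Suc n) \<omega> i \<partial>M)"
      using loynes_incseq i by (intro integral_mono integrable_loynes) auto
    also have "\<dots> = (\<integral>\<omega>. jsw_step N (\<sigma> \<omega>) (\<tau> \<omega>) (loynes N n \<omega>) i \<partial>M)"
      unfolding loynes_Suc by (rule integral_shift_inv[OF integrable_loynes(2)[OF i]])
    finally show ?thesis using integrable_loynes[OF i] by simp
  qed
  moreover have "(\<integral>\<omega>. (\<Sum>i\<in>I. jsw_step N (\<sigma> \<omega>) (\<tau> \<omega>) (loynes N n \<omega>) i - loynes N n \<omega> i) \<partial>M)
    = (\<Sum>i\<in>I. \<integral>\<omega>. jsw_step N (\<sigma> \<omega>) (\<tau> \<omega>) (loynes N n \<omega>) i - loynes N n \<omega> i \<partial>M)"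
    using assms integrable_loynes by (intro Bochner_Integration.integral_sum) auto
  ultimately show ?thesis by (simp add: sum_nonneg)
qed

section \<open>Finiteness of the limit\<close>

text \<open>The thresholds are natural numbers, so that the event is measurable as a countable
  combination of events.\<close>

definition explodes :: "nat \<Rightarrow> nat \<Rightarrow> 'a \<Rightarrow> bool" where
  "explodes N i \<omega> \<longleftrightarrow> (\<forall>K::nat. \<exists>n. real K < loynes N n \<omega> i)"

lemma not_explodesD:
  assumes "\<not> explodes N i \<omega>"
  obtains K where "\<And>n. loynes N n \<omega> i \<le> K"
  using assms unfolding explodes_def by (meson not_less)

lemma explodes_eventually_ge:
  assumes "explodes N i \<omega>" "i \<in> {1..N}"
  shows "eventually (\<lambda>n. c \<le> loynes N n \<omega> i) sequentially"
proof -
  obtain K :: nat where "c \<le> real K" using real_arch_simple by blast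
  moreover obtain m where "real K < loynes N m \<omega> i" using assms unfolding explodes_def by blast
  ultimately have "c \<le> loynes N n \<omega> i" if "m \<le> n" for n
    using incseqD[OF incseq_loynes[OF assms(2)] that, of \<omega>] by linarith
  then show ?thesis unfolding eventually_sequentially by blast
qed

lemma explodes_transfer:
  assumes "\<And>n. loynes N n \<omega>1 i \<le> loynes N (n + d) \<omega>2 i + c" "explodes N i \<omega>1"
  shows "explodes N i \<omega>2"
  unfolding explodes_def
proof
  fix K :: nat
  obtain K' :: nat where K': "real K + c \<le> real K'" using real_arch_simple by blast
  obtain n where "real K' < loynes N n \<omega>1 i" using assms(2) unfolding explodes_def by blast
  with assms(1)[of n] K' have "real K < loynes N (n + d) \<omega>2 i" by linarith
  then show "\<exists>n. real K < loynes N n \<omega>2 i" by blast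
qed

text \<open>By \<open>AE_increment\<close>, the coordinate at \<open>\<theta> \<omega>\<close> and the one at \<open>\<omega>\<close> differ by at most \<open>\<sigma> \<omega>\<close>
  or \<open>\<tau> \<omega>\<close>, up to a shift of the index of the sequence.\<close>

lemma explodes_0_or_1:
  assumes i: "i \<in> {1..N}"
  shows "(AE \<omega> in M. \<not> explodes N i \<omega>) \<or> (AE \<omega> in M. explodes N i \<omega>)"
proof -
  define A where "A = {\<omega> \<in> space M. explodes N i \<omega>}"
  have [measurable]: "(\<lambda>\<omega>. loynes N n \<omega> i) \<in> borel_measurable M" for n
    by (rule borel_measurable_loynes[OF i])
  have A: "A \<in> sets M" unfolding A_def explodes_def by measurable
  have "AE \<omega> in M. \<theta> \<omega> \<in> A \<longleftrightarrow> \<omega> \<in> A"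
    using AE_increment[OF i] AE_space
  proof eventually_elim
    case (elim \<omega>)
    have le: "loynes N n \<omega> i \<le> loynes N (Suc n) (\<theta> \<omega>) i + \<tau> \<omega>" for n
      using elim by (simp add: loynes_Suc_shift algebra_simps)
    have ge: "loynes N n (\<theta> \<omega>) i \<le> loynes N n \<omega> i + \<sigma> \<omega>" for n
      using elim incseqD[OF incseq_loynes[OF i] le_SucI[OF order_refl], of n "\<theta> \<omega>"]
      by (auto simp: loynes_Suc_shift intro: order_trans)
    have "explodes N i (\<theta> \<omega>) \<longleftrightarrow> explodes N i \<omega>"
      using explodes_transfer[of N \<omega> i 1 "\<theta> \<omega>" "\<tau> \<omega>"] explodes_transfer[of N "\<theta> \<omega>" i 0 \<omega> "\<sigma> \<omega>"] le ge
      by auto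
    then show ?case using elim measurable_space[OF measurable_shift] by (auto simp: A_def)
  qed
  from ergodic_AE[OF A this] show ?thesis
  proof
    assume "prob A = 0"
    then have "AE \<omega> in M. \<omega> \<notin> A" using A by (simp add: prob_eq_0)
    from this AE_space have "AE \<omega> in M. \<not> explodes N i \<omega>"
      by eventually_elim (simp add: A_def)
    then show ?thesis ..
  next
    assume "prob A = 1"
    then have "AE \<omega> in M. \<omega> \<in> A" using A by (simp add: prob_eq_1)
    then have "AE \<omega> in M. explodes N i \<omega>" by eventually_elim (simp add: A_def)
    then show ?thesis ..
  qed
qed

text \<open>In the tail of coordinates above \<open>j\<close>, the increment of one step is eventually constant in
  the index of the sequence, with value \<open>(if j = 0 then \<sigma> else 0) - (N - j) \<tau>\<close>, and it is dominated
  by \<open>(N - j) (\<sigma> + \<tau>)\<close>. The nonnegative means of the increments thus pass to the limit, whose mean is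
  negative.\<close>

lemma not_explodes_tail:
  assumes j: "j < N"
    and load: "(\<integral>\<omega>. \<sigma> \<omega> \<partial>M) < real N * (\<integral>\<omega>. \<tau> \<omega> \<partial>M)"
    and tail: "AE \<omega> in M. explodes N (Suc j) \<omega>"
    and head: "0 < j \<Longrightarrow> AE \<omega> in M. \<not> explodes N j \<omega>"
  shows False
proof -
  let ?I = "{Suc j..N}"
  define h where "h n \<omega> = (\<Sum>i\<in>?I. jsw_step N (\<sigma> \<omega>) (\<tau> \<omega>) (loynes N n \<omega>) i - loynes N n \<omega> i)"
    for n \<omega>
  define f where "f \<omega> = (if j = 0 then \<sigma> \<omega> else 0) - real (N - j) * \<tau> \<omega>" for \<omega>
  have sub: "?I \<subseteq> {1..N}" by auto
  have head': "AE \<omega> in M. 0 < j \<longrightarrow> \<not> explodes N j \<omega>" using head by (cases "0 < j") auto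
  have lim: "AE \<omega> in M. (\<lambda>n. h n \<omega>) \<longlonglongrightarrow> f \<omega>"
    using tail head' service_nonneg interarrival_pos
  proof eventually_elim
    case (elim \<omega>)
    have sj: "Suc j \<in> {1..N}" using j by auto
    obtain K where K: "0 < j \<Longrightarrow> loynes N n \<omega> 1 \<le> K" for n
    proof (cases "0 < j")
      case True
      then obtain K where "\<And>n. loynes N n \<omega> j \<le> K" using elim not_explodesD by blast
      moreover have "loynes N n \<omega> 1 \<le> loynes N n \<omega> j" for n
        using ordered_orthantD(2)[OF loynes_ordered, of 1 N j] True j by auto
      ultimately show ?thesis using that order_trans by blast
    qed (use that in auto)
    \<comment> \<open>From \<open>\<tau>\<close> on, every tail server removes the full amount \<open>\<tau>\<close>; from \<open>K + \<sigma>\<close> on, if \<open>j > 0\<close>, the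
      arriving work is inserted below the tail.\<close>
    have "eventually (\<lambda>n. max (\<tau> \<omega>) (K + \<sigma> \<omega>) \<le> loynes N n \<omega> (Suc j)) sequentially"
      using explodes_eventually_ge[OF _ sj] elim by blast
    then have "eventually (\<lambda>n. h n \<omega> = f \<omega>) sequentially"
    proof eventually_elim
      case large: (elim n)
      let ?u = "loynes N n \<omega>" and ?x = "join_shortest N (\<sigma> \<omega>) (loynes N n \<omega>)"
      have u_large: "max (\<tau> \<omega>) (K + \<sigma> \<omega>) \<le> ?u i" if "i \<in> ?I" for i
        using ordered_orthantD(2)[OF loynes_ordered sj, of i n \<omega>] that large by auto
      have "jsw_step N (\<sigma> \<omega>) (\<tau> \<omega>) ?u i = ?x i - \<tau> \<omega>" if "i \<in> ?I" for i
        using u_large[OF that] join_shortest_ge[of ?u i N "\<sigma> \<omega>"] that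
        by (auto simp: jsw_step_eq)
      then have h: "h n \<omega> = (\<Sum>i\<in>?I. ?x i - ?u i) - real (N - j) * \<tau> \<omega>"
        by (simp add: h_def sum_subtractf)
      have "(\<Sum>i\<in>?I. ?x i - ?u i) = (if j = 0 then \<sigma> \<omega> else 0)"
      proof (cases "j = 0")
        case True
        then show ?thesis
          using sum_join_shortest[OF loynes_ordered[of N n \<omega>], of "\<sigma> \<omega>"] elim j
          by (simp add: sum_subtractf)
      next
        case False
        have "?x i = ?u i" if "i \<in> ?I" for i
          using u_large[OF that] K[of n] False by (auto simp: join_shortest_def)
        then show ?thesis using False by simp
      qed
      then show ?case by (simp add: h f_def)
    qed
    then show ?case by (rule tendsto_eventually)
  qed
  have pos: "\<not> real (N - j) * (\<integral>\<omega>. \<tau> \<omega> \<partial>M) \<le> 0"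
    using mult_pos_pos[of "real (N - j)", OF _ interarrival_mean_pos] j by linarith
  have f_int: "integrable M f"
    unfolding f_def using integrable_service integrable_interarrival by (cases "j = 0") auto
  have "(\<lambda>n. \<integral>\<omega>. h n \<omega> \<partial>M) \<longlonglongrightarrow> (\<integral>\<omega>. f \<omega> \<partial>M)"
  proof (rule integral_dominated_convergence[OF _ _ _ lim])
    show "integrable M (\<lambda>\<omega>. \<Sum>i\<in>?I. \<sigma> \<omega> + \<tau> \<omega>)"
      using integrable_service integrable_interarrival by simp
    show "f \<in> borel_measurable M" using f_int by simp
    show "h n \<in> borel_measurable M" for n
      unfolding h_def using integrable_loynes sub
      by (intro borel_measurable_sum borel_measurable_diff borel_measurable_integrable) auto
    fix n
    have "AE \<omega> in M. \<forall>i\<in>?I.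
        \<bar>jsw_step N (\<sigma> \<omega>) (\<tau> \<omega>) (loynes N n \<omega>) i - loynes N n \<omega> i\<bar> \<le> \<sigma> \<omega> + \<tau> \<omega>"
    proof (rule AE_finite_allI)
      fix i assume "i \<in> ?I"
      then have "i \<in> {1..N}" by auto
      from AE_increment[OF this] service_nonneg interarrival_pos
      show "AE \<omega> in M.
        \<bar>jsw_step N (\<sigma> \<omega>) (\<tau> \<omega>) (loynes N n \<omega>) i - loynes N n \<omega> i\<bar> \<le> \<sigma> \<omega> + \<tau> \<omega>"
      proof eventually_elim
        case (elim \<omega>)
        then show ?case by (auto simp: abs_le_iff dest!: spec[of _ n])
      qed
    qed simp
    then show "AE \<omega> in M. norm (h n \<omega>) \<le> (\<Sum>i\<in>?I. \<sigma> \<omega> + \<tau> \<omega>)"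
    proof eventually_elim
      case (elim \<omega>)
      have "norm (h n \<omega>) \<le>
          (\<Sum>i\<in>?I. \<bar>jsw_step N (\<sigma> \<omega>) (\<tau> \<omega>) (loynes N n \<omega>) i - loynes N n \<omega> i\<bar>)"
        unfolding h_def real_norm_def by (rule sum_abs)
      also have "\<dots> \<le> (\<Sum>i\<in>?I. \<sigma> \<omega> + \<tau> \<omega>)" using elim by (intro sum_mono) auto
      finally show ?case .
    qed
  qed
  then have "0 \<le> (\<integral>\<omega>. f \<omega> \<partial>M)"
    by (rule LIMSEQ_le_const) (use mean_increment_nonneg[OF sub] in \<open>auto simp: h_def\<close>)
  moreover have "(\<integral>\<omega>. f \<omega> \<partial>M) =
      (if j = 0 then \<integral>\<omega>. \<sigma> \<omega> \<partial>M else 0) - real (N - j) * (\<integral>\<omega>. \<tau> \<omega> \<partial>M)"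
    unfolding f_def using integrable_service integrable_interarrival by (cases "j = 0") auto
  ultimately have "real (N - j) * (\<integral>\<omega>. \<tau> \<omega> \<partial>M) \<le> (if j = 0 then \<integral>\<omega>. \<sigma> \<omega> \<partial>M else 0)"
    by simp
  with load have "j \<noteq> 0 \<and> real (N - j) * (\<integral>\<omega>. \<tau> \<omega> \<partial>M) \<le> 0"
    by (cases "j = 0") simp_all
  with pos show False by blast
qed

text \<open>Induction on \<open>i\<close> provides a finite coordinate just below the tail.\<close>

lemma AE_not_explodes:
  assumes load: "(\<integral>\<omega>. \<sigma> \<omega> \<partial>M) < real N * (\<integral>\<omega>. \<tau> \<omega> \<partial>M)" and "i \<in> {1..N}"
  shows "AE \<omega> in M. \<not> explodes N i \<omega>"
  using \<open>i \<in> {1..N}\<close>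
proof (induction i)
  case (Suc j)
  show ?case
  proof (rule ccontr)
    assume "\<not> ?case"
    then have "AE \<omega> in M. explodes N (Suc j) \<omega>" using explodes_0_or_1[OF Suc.prems] by blast
    then show False using not_explodes_tail[OF _ load, of j] Suc by auto
  qed
qed simp

section \<open>Existence of the minimal solution\<close>

lemma loynes_le_solution:
  assumes Y: "stationary_profile M \<theta> \<sigma> \<tau> N Y"
  shows "AE \<omega> in M. \<forall>i\<in>{1..N}. loynes N n \<omega> i \<le> Y \<omega> i"
proof (induction n)
  case 0
  show ?case
    using AE_space
  proof eventually_elim
    case (elim \<omega>)
    then have "Y \<omega> \<in> ordered_orthant N" using Y by (auto simp: stationary_profile_def)
    then show ?case using ordered_orthantD(1) by auto
  qed
next
  case (Suc n)
  have "AE \<omega> in M. Y (\<theta> \<omega>) = jsw_step N (\<sigma> \<omega>) (\<tau> \<omega>) (Y \<omega>)"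
    using Y by (simp add: stationary_profile_def)
  from AE_shift_inv[OF this] AE_shift_inv[OF Suc] AE_space show ?case
  proof eventually_elim
    case (elim \<omega>)
    then have "Y \<omega> = jsw_step N (\<sigma> (shift_inv \<omega>)) (\<tau> (shift_inv \<omega>)) (Y (shift_inv \<omega>))"
      by (simp add: shift_shift_inv)
    then show ?case unfolding loynes_Suc using elim by (auto intro!: jsw_step_mono)
  qed
qed

text \<open>The witness is the limit of the Loynes sequence, set to the empty profile on a null set
  because a profile has to be finite and ordered at every point of the space.\<close>

lemma is_minimal_solution_exists:
  assumes load: "(\<integral>\<omega>. \<sigma> \<omega> \<partial>M) < real N * (\<integral>\<omega>. \<tau> \<omega> \<partial>M)"
  shows "\<exists>W. is_minimal_solution M \<theta> \<sigma> \<tau> N W"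
proof -
  have "AE \<omega> in M. \<forall>i\<in>{1..N}. \<not> explodes N i \<omega>"
    by (intro AE_finite_allI AE_not_explodes[OF load]) auto
  then obtain Z where Z: "Z \<in> null_sets M"
    and bounded: "\<And>\<omega>. \<omega> \<in> space M - Z \<Longrightarrow> \<forall>i\<in>{1..N}. \<not> explodes N i \<omega>"
    by (rule AE_E3) blast
  define W where "W \<omega> = (\<lambda>i\<in>{1..N}. if \<omega> \<in> Z then 0 else lim (\<lambda>n. loynes N n \<omega> i))" for \<omega>
  have conv: "(\<lambda>n. loynes N n \<omega> i) \<longlonglongrightarrow> W \<omega> i" if \<omega>: "\<omega> \<in> space M - Z" and i: "i \<in> {1..N}" for \<omega> i
  proof -
    have "\<not> explodes N i \<omega>" using bounded \<omega> i by blast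
    then obtain K where K: "\<And>n. loynes N n \<omega> i \<le> K" by (rule not_explodesD) blast
    obtain l where "(\<lambda>n. loynes N n \<omega> i) \<longlonglongrightarrow> l"
      using incseq_convergent[OF incseq_loynes[OF i]] K by blast
    then show ?thesis using \<omega> i by (simp add: W_def limI)
  qed
  have AE_conv: "AE \<omega> in M. \<forall>i\<in>{1..N}. (\<lambda>n. loynes N n \<omega> i) \<longlonglongrightarrow> W \<omega> i"
    using AE_not_in[OF Z] AE_space by eventually_elim (use conv in auto)
  have orthant: "W \<omega> \<in> ordered_orthant N" if "\<omega> \<in> space M" for \<omega>
  proof (cases "\<omega> \<in> Z")
    case True
    then show ?thesis using zero_in_ordered_orthant by (simp add: W_def cong: restrict_cong)
  next
    case False
    have "0 \<le> W \<omega> i" if "i \<in> {1..N}" for i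
      using conv[of \<omega> i] \<open>\<omega> \<in> space M\<close> False that ordered_orthantD(1)[OF loynes_ordered that]
      by (intro LIMSEQ_le_const) auto
    moreover have "W \<omega> i \<le> W \<omega> k" if "i \<in> {1..N}" "k \<in> {1..N}" "i \<le> k" for i k
      using conv[of \<omega>] \<open>\<omega> \<in> space M\<close> False that ordered_orthantD(2)[OF loynes_ordered that]
      by (intro LIMSEQ_le[of "\<lambda>n. loynes N n \<omega> i" _ "\<lambda>n. loynes N n \<omega> k"]) auto
    ultimately show ?thesis by (auto simp: ordered_orthant_def W_def)
  qed
  have meas: "W \<in> measurable M (PiM {1..N} (\<lambda>_. borel))"
    unfolding W_def
  proof (rule measurable_restrict)
    fix i assume "i \<in> {1..N}"
    then have [measurable]: "(\<lambda>\<omega>. loynes N n \<omega> i) \<in> borel_measurable M" for n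
      by (rule borel_measurable_loynes)
    have [measurable]: "Z \<in> sets M" using Z by auto
    show "(\<lambda>\<omega>. if \<omega> \<in> Z then 0 else lim (\<lambda>n. loynes N n \<omega> i)) \<in> borel_measurable M"
      by measurable
  qed
  have "AE \<omega> in M. W (\<theta> \<omega>) = jsw_step N (\<sigma> \<omega>) (\<tau> \<omega>) (W \<omega>)"
    using AE_conv AE_shift[OF AE_conv] AE_space
  proof eventually_elim
    case (elim \<omega>)
    show ?case
    proof
      fix i
      show "W (\<theta> \<omega>) i = jsw_step N (\<sigma> \<omega>) (\<tau> \<omega>) (W \<omega>) i"
      proof (cases "i \<in> {1..N}")
        case True
        have "(\<lambda>n. loynes N (Suc n) (\<theta> \<omega>) i) \<longlonglongrightarrow> jsw_step N (\<sigma> \<omega>) (\<tau> \<omega>) (W \<omega>) i"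
          using elim True by (simp only: loynes_Suc_shift) (intro tendsto_jsw_step, auto)
        moreover have "(\<lambda>n. loynes N (Suc n) (\<theta> \<omega>) i) \<longlonglongrightarrow> W (\<theta> \<omega>) i"
          using elim True by (intro LIMSEQ_Suc) auto
        ultimately show ?thesis by (rule LIMSEQ_unique[symmetric])
      next
        case False
        then show ?thesis unfolding W_def jsw_step_def by (simp only: restrict_apply if_False)
      qed
    qed
  qed
  then have "stationary_profile M \<theta> \<sigma> \<tau> N W"
    using meas orthant by (simp add: stationary_profile_def)
  moreover have "AE \<omega> in M. \<forall>i\<in>{1..N}. W \<omega> i \<le> Y \<omega> i"
    if Y: "stationary_profile M \<theta> \<sigma> \<tau> N Y" for Y
  proof -
    have "AE \<omega> in M. \<forall>n. \<forall>i\<in>{1..N}. loynes N n \<omega> i \<le> Y \<omega> i"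
      unfolding AE_all_countable using loynes_le_solution[OF Y] by blast
    with AE_conv show ?thesis
      by eventually_elim (auto intro: LIMSEQ_le_const2)
  qed
  ultimately show ?thesis using AE_conv unfolding is_minimal_solution_def by blast
qed

lemma loynes_tendsto_minimal_solution:
  assumes "(\<integral>\<omega>. \<sigma> \<omega> \<partial>M) < real N * (\<integral>\<omega>. \<tau> \<omega> \<partial>M)"
  shows "AE \<omega> in M. \<forall>i\<in>{1..N}.
    (\<lambda>n. loynes N n \<omega> i) \<longlonglongrightarrow> minimal_solution M \<theta> \<sigma> \<tau> N \<omega> i"
  using someI_ex[OF is_minimal_solution_exists[OF assms]]
  unfolding minimal_solution_def is_minimal_solution_def by blast

section \<open>Comparison of the minimal solutions\<close>

lemma prec_loynes:
  assumes "1 \<le> S'"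
  shows "AE \<omega> in M. prec (d + S') S' (loynes (d + S') n \<omega>) (loynes S' n \<omega>)"
proof (induction n)
  case 0
  show ?case using assms by (simp add: prec_iff)
next
  case (Suc n)
  show ?case
    using AE_shift_inv[OF Suc] AE_shift_inv[OF service_nonneg] AE_shift_inv[OF interarrival_pos]
    by eventually_elim
      (unfold loynes_Suc, intro prec_jsw_step loynes_ordered, use assms in auto)
qed

end

theorem theorem3:
  fixes M :: "'a measure" and \<theta> :: "'a \<Rightarrow> 'a" and \<sigma> \<tau> :: "'a \<Rightarrow> real" and S S' :: nat
  assumes "palm_setting M \<theta> \<sigma> \<tau>"
    and "1 \<le> S'" and "S' \<le> S"
    and "(\<integral>\<omega>. \<sigma> \<omega> \<partial>M) < real S' * (\<integral>\<omega>. \<tau> \<omega> \<partial>M)"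
  shows "AE \<omega> in M. prec S S' (minimal_solution M \<theta> \<sigma> \<tau> S \<omega>) (minimal_solution M \<theta> \<sigma> \<tau> S' \<omega>)"
proof -
  interpret palm_setting M \<theta> \<sigma> \<tau> by fact
  define d where "d = S - S'"
  have S: "S = d + S'" using \<open>S' \<le> S\<close> by (simp add: d_def)
  have "real S' * (\<integral>\<omega>. \<tau> \<omega> \<partial>M) \<le> real S * (\<integral>\<omega>. \<tau> \<omega> \<partial>M)"
    using interarrival_mean_pos \<open>S' \<le> S\<close> by (intro mult_right_mono) auto
  then have load: "(\<integral>\<omega>. \<sigma> \<omega> \<partial>M) < real S * (\<integral>\<omega>. \<tau> \<omega> \<partial>M)" using assms(4) by linarith
  have "AE \<omega> in M. \<forall>n. prec (d + S') S' (loynes (d + S') n \<omega>) (loynes S' n \<omega>)"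
    unfolding AE_all_countable using prec_loynes[OF \<open>1 \<le> S'\<close>] by blast
  with loynes_tendsto_minimal_solution[OF load] loynes_tendsto_minimal_solution[OF assms(4)]
  show ?thesis
    unfolding S
  proof eventually_elim
    case (elim \<omega>)
    show ?case
      by (rule prec_tendsto[OF \<open>1 \<le> S'\<close>,
            where u = "\<lambda>n. loynes (d + S') n \<omega>" and v = "\<lambda>n. loynes S' n \<omega>"])
        (use elim in blast)+
  qed
qed

end
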